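(* Let $I_1,I_2\subseteq\mathbb{R}$ be intervals and let $\alpha=\alpha(t)$, $t\in I_1$, and $\omega=\omega(s)$, $s\in I_2$, be (smooth) regular planar curves with values in $\mathbb{C}\setminus\{0\}$. For any $t_0\in I_1$ and $s_0\in I_2$ define $\Phi=\alpha\ast\omega: I_1\times I_2\to\mathbb{C}^2$ by $$\Phi(t,s)=\left(\int_{s_0}^s\dot\omega(y)\overline{\omega(y)}\,dy-\int_{t_0}^t\alpha'(x)\overline{\alpha(x)}\,dx\, ,\ \alpha(t)\omega(s)\right).$$ Then the following hold. (1) $\Phi$ is a Lagrangian immersion with induced metric $$\Phi^*\langle\ ,\ \rangle=\left(|\alpha|^2+|\omega|^2\right)\left(|\alpha'|^2dt^2+|\dot\omega|^2ds^2\right).$$ (2) The fully symmetric tensor $C(\cdot,\cdot,\cdot)=\langle\sigma(\cdot,\cdot),J\cdot\rangle$ of $\Phi$ is given by $$C(\partial_t,\partial_t,\partial_t)=|\alpha'|^2\left((|\alpha|^2+|\omega|^2)|\alpha'|\kappa_\alpha-\langle\alpha',J\alpha\rangle\right),$$ $$C(\partial_t,\partial_t,\partial_s)=|\alpha'|^2\langle\dot\omega,J\omega\rangle,$$ $$C(\partial_t,\partial_s,\partial_s)=|\dot\omega|^2\langle\alpha',J\alpha\rangle,$$ $$C(\partial_s,\partial_s,\partial_s)=|\dot\omega|^2\left((|\alpha|^2+|\omega|^2)|\dot\omega|\kappa_\omega-\langle\dot\omega,J\omega\rangle\right).$$ (3) The Lagrangian angle map of $\Phi$ is $\beta=\arg(\alpha')+\arg(\dot\omega)+\pi$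 (modulo $2\pi$). (4) The mean curvature vector of $\Phi$ is $$H=\frac{1}{|\alpha|^2+|\omega|^2}\left(\frac{\kappa_\alpha}{|\alpha'|}J\Phi_t+\frac{\kappa_\omega}{|\dot\omega|}J\Phi_s\right).$$
   Context: Primes denote derivatives with respect to $t$ and dots derivatives with respect to $s$. On $\mathbb{C}^2$ the Hermitian product is $(z,w)=z_1\bar w_1+z_2\bar w_2$, the Euclidean metric is $\langle\ ,\ \rangle=\mathrm{Re}(\ ,\ )$, $J$ is the complex structure (multiplication by $i$), and the Kaehler form is $-\mathrm{Im}(\ ,\ )=\langle J\cdot,\cdot\rangle$. An immersion of a surface in $\mathbb{C}^2$ is Lagrangian if the Kaehler form pulls back to zero. On $\mathbb{C}\equiv\mathbb{R}^2$, $J$ also denotes rotation by $+\pi/2$ and $\langle\ ,\ \rangle$ the Euclidean inner product. $\sigma$ is the second fundamental form of the immersion, and $H=\mathrm{trace}\,\sigma$ (trace with respect to the induced metric, with no factor $1/2$). $C$ is evaluated on vectors tangent to the surface, identified with their images under the differential of $\Phi$. $\kappa_\alpha,\kappa_\omega$ are the signed curvatures of the planar curves, so $(\arg\alpha')'=|\alpha'|\kappa_\alpha$ and $(\arg\dot\omega)\dot{}=|\dot\omega|\kappa_\omega$. The Lagrangian angle $\beta$ (with values in $\mathbb{R}/2\pi\mathbb{Z}$) of a Lagrangian immersion of an oriented surface $M$ is defined by $\Phi^*(dz_1\wedge dz_2)=e^{i\beta}\omega_M$, with $\omega_M$ the area form; here $I_1\times I_2$ is oriented by $(\partial_t,\partial_s)$.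 *)

theory Defs
  imports "HOL-Analysis.Analysis" "HOL-Library.Real_Mod"
begin

section \<open>Smooth maps\<close>

text \<open>
  Intervals may contain their endpoints, so every derivative is taken within the domain.  All
  domains in use are nondegenerate intervals and products of two of them: convex sets with
  nonempty interior, on which the derivative within the set is unique.
\<close>

primrec Ck_on :: "nat \<Rightarrow> 'a::real_normed_vector set \<Rightarrow> ('a \<Rightarrow> 'b::real_normed_vector) \<Rightarrow> bool" where
  "Ck_on 0 S f \<longleftrightarrow> continuous_on S f"
| "Ck_on (Suc k) S f \<longleftrightarrow>
     (\<exists>f'. (\<forall>x\<in>S. (f has_derivative f' x) (at x within S)) \<and> (\<forall>v. Ck_on k S (\<lambda>x. f' x v)))"

definition smooth_on :: "'a::real_normed_vector set \<Rightarrow> ('a \<Rightarrow> 'b::real_normed_vector) \<Rightarrow> bool" where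
  "smooth_on S f \<longleftrightarrow> (\<forall>k. Ck_on k S f)"


section \<open>Planar curves\<close>

abbreviation velocity :: "real set \<Rightarrow> (real \<Rightarrow> complex) \<Rightarrow> real \<Rightarrow> complex" where
  "velocity I \<gamma> t \<equiv> vector_derivative \<gamma> (at t within I)"

definition regular_curve_on :: "real set \<Rightarrow> (real \<Rightarrow> complex) \<Rightarrow> bool" where
  "regular_curve_on I \<gamma> \<longleftrightarrow> smooth_on I \<gamma> \<and> (\<forall>t\<in>I. velocity I \<gamma> t \<noteq> 0)"

definition continuous_arg_on :: "real set \<Rightarrow> (real \<Rightarrow> complex) \<Rightarrow> (real \<Rightarrow> real) \<Rightarrow> bool" where
  "continuous_arg_on I f \<theta> \<longleftrightarrow>
     continuous_on I \<theta> \<and> (\<forall>t\<in>I. f t = complex_of_real (cmod (f t)) * cis (\<theta> t))"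

text \<open>
  The curvature \<open>\<kappa>\<close> of \<open>\<gamma>\<close> is given by \<open>(arg \<gamma>')' = \<bar>\<gamma>'\<bar> \<kappa>\<close>.  Here \<open>arg \<gamma>'\<close> is any continuous
  determination of the argument along the curve; two of them differ by a constant.
\<close>

definition signed_curvature :: "real set \<Rightarrow> (real \<Rightarrow> complex) \<Rightarrow> real \<Rightarrow> real" where
  "signed_curvature I \<gamma> t = (THE \<kappa>. \<exists>\<theta>. continuous_arg_on I (velocity I \<gamma>) \<theta> \<and>
     (\<theta> has_real_derivative cmod (velocity I \<gamma> t) * \<kappa>) (at t within I))"


section \<open>Parametrized surfaces in complex 2-space\<close>

text \<open>
  Complex 2-space is \<^typ>\<open>complex \<times> complex\<close>; the library's inner product on this type is the
  Euclidean metric, the real part of the Hermitian product.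
\<close>

definition hermitian :: "complex \<times> complex \<Rightarrow> complex \<times> complex \<Rightarrow> complex" where
  "hermitian z w = fst z * cnj (fst w) + snd z * cnj (snd w)"

definition J :: "complex \<times> complex \<Rightarrow> complex \<times> complex" where
  "J z = (\<i> * fst z, \<i> * snd z)"

definition kaehler_form :: "complex \<times> complex \<Rightarrow> complex \<times> complex \<Rightarrow> real" where
  "kaehler_form z w = - Im (hermitian z w)"

definition dz1_wedge_dz2 :: "complex \<times> complex \<Rightarrow> complex \<times> complex \<Rightarrow> complex" where
  "dz1_wedge_dz2 z w = fst z * snd w - fst w * snd z"

type_synonym surface = "real \<times> real \<Rightarrow> complex \<times> complex"

text \<open>Tangent vectors of the parameter domain are pairs; the coordinates are \<open>(t, s)\<close>.\<close>

abbreviation (input) d_t :: "real \<times> real" ("\<partial>\<^sub>t") where "\<partial>\<^sub>t \<equiv> (1, 0)"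
abbreviation (input) d_s :: "real \<times> real" ("\<partial>\<^sub>s") where "\<partial>\<^sub>s \<equiv> (0, 1)"

definition differential ::
  "(real \<times> real) set \<Rightarrow> surface \<Rightarrow> real \<times> real \<Rightarrow> real \<times> real \<Rightarrow> complex \<times> complex" where
  "differential U X p = frechet_derivative X (at p within U)"

definition immersion_on :: "(real \<times> real) set \<Rightarrow> surface \<Rightarrow> bool" where
  "immersion_on U X \<longleftrightarrow> smooth_on U X \<and> (\<forall>p\<in>U. inj (differential U X p))"

definition lagrangian_immersion_on :: "(real \<times> real) set \<Rightarrow> surface \<Rightarrow> bool" where
  "lagrangian_immersion_on U X \<longleftrightarrow> immersion_on U X \<and>
     (\<forall>p\<in>U. \<forall>u v. kaehler_form (differential U X p u) (differential U X p v) = 0)"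

definition induced_metric ::
  "(real \<times> real) set \<Rightarrow> surface \<Rightarrow> real \<times> real \<Rightarrow> real \<times> real \<Rightarrow> real \<times> real \<Rightarrow> real" where
  "induced_metric U X p u v = differential U X p u \<bullet> differential U X p v"

definition normal_component ::
  "(complex \<times> complex) set \<Rightarrow> complex \<times> complex \<Rightarrow> complex \<times> complex" where
  "normal_component T w = (THE n. (\<forall>x\<in>T. n \<bullet> x = 0) \<and> w - n \<in> T)"

text \<open>
  The second fundamental form \<open>\<sigma>(u, v)\<close> is the normal component of the ambient derivative, in
  direction \<open>u\<close>, of the tangent field \<open>q \<mapsto> dX\<^sub>q(v)\<close>, where \<open>v\<close> is extended as the
  field with constant coordinates.
\<close>

definition second_fundamental_form ::
  "(real \<times> real) set \<Rightarrow> surface \<Rightarrow> real \<times> real \<Rightarrow> real \<times> real \<Rightarrow> real \<times> real \<Rightarrow> complex \<times> complex" where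
  "second_fundamental_form U X p u v =
     normal_component (range (differential U X p))
       (frechet_derivative (\<lambda>q. differential U X q v) (at p within U) u)"

definition C_tensor ::
  "(real \<times> real) set \<Rightarrow> surface \<Rightarrow> real \<times> real \<Rightarrow>
     real \<times> real \<Rightarrow> real \<times> real \<Rightarrow> real \<times> real \<Rightarrow> real" where
  "C_tensor U X p u v w = second_fundamental_form U X p u v \<bullet> J (differential U X p w)"

definition fully_symmetric_tensor ::
  "(real \<times> real \<Rightarrow> real \<times> real \<Rightarrow> real \<times> real \<Rightarrow> real) \<Rightarrow> bool" where
  "fully_symmetric_tensor T \<longleftrightarrow> (\<forall>v w. linear (\<lambda>u. T u v w)) \<and>
     (\<forall>u v w. T u v w = T v u w \<and> T u v w = T u w v)"

definition gram_det :: "(real \<times> real) set \<Rightarrow> surface \<Rightarrow> real \<times> real \<Rightarrow> real" where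
  "gram_det U X p =
     induced_metric U X p \<partial>\<^sub>t \<partial>\<^sub>t * induced_metric U X p \<partial>\<^sub>s \<partial>\<^sub>s - (induced_metric U X p \<partial>\<^sub>t \<partial>\<^sub>s)\<^sup>2"

text \<open>
  The trace \<open>\<Sum> g\<^sup>i\<^sup>j \<sigma>(\<partial>\<^sub>i, \<partial>\<^sub>j)\<close> with respect to the induced
  metric, with the inverse of the Gram matrix written out; there is no factor \<open>1/2\<close>.
\<close>

definition mean_curvature_vector ::
  "(real \<times> real) set \<Rightarrow> surface \<Rightarrow> real \<times> real \<Rightarrow> complex \<times> complex" where
  "mean_curvature_vector U X p =
     (let g = induced_metric U X p; \<sigma> = second_fundamental_form U X p
      in (1 / gram_det U X p) *\<^sub>R
           (g \<partial>\<^sub>s \<partial>\<^sub>s *\<^sub>R \<sigma> \<partial>\<^sub>t \<partial>\<^sub>t - g \<partial>\<^sub>t \<partial>\<^sub>s *\<^sub>R \<sigma> \<partial>\<^sub>t \<partial>\<^sub>s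
            - g \<partial>\<^sub>t \<partial>\<^sub>s *\<^sub>R \<sigma> \<partial>\<^sub>s \<partial>\<^sub>t + g \<partial>\<^sub>t \<partial>\<^sub>t *\<^sub>R \<sigma> \<partial>\<^sub>s \<partial>\<^sub>s))"

text \<open>The domain is oriented by \<open>(\<partial>\<^sub>t, \<partial>\<^sub>s)\<close>.\<close>

definition area_form ::
  "(real \<times> real) set \<Rightarrow> surface \<Rightarrow> real \<times> real \<Rightarrow> real \<times> real \<Rightarrow> real \<times> real \<Rightarrow> real" where
  "area_form U X p u v = sqrt (gram_det U X p) * (fst u * snd v - fst v * snd u)"

text \<open>
  An angle in \<open>\<real>/2\<pi>\<int>\<close> is represented by the set of all its real representatives.
\<close>

definition angle_class :: "real \<Rightarrow> real set" where
  "angle_class a = {b. [b = a] (rmod (2 * pi))}"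

definition lagrangian_angle :: "(real \<times> real) set \<Rightarrow> surface \<Rightarrow> real \<times> real \<Rightarrow> real set" where
  "lagrangian_angle U X p =
     {\<beta>. \<forall>u v. dz1_wedge_dz2 (differential U X p u) (differential U X p v)
                = cis \<beta> * complex_of_real (area_form U X p u v)}"


section \<open>The surface built from two planar curves\<close>

text \<open>The interval integrals are oriented: \<open>s < s\<^sub>0\<close> and \<open>t < t\<^sub>0\<close> are allowed.\<close>

definition curve_product ::
  "real set \<Rightarrow> real set \<Rightarrow> real \<Rightarrow> real \<Rightarrow> (real \<Rightarrow> complex) \<Rightarrow> (real \<Rightarrow> complex) \<Rightarrow> surface" where
  "curve_product I1 I2 t0 s0 \<alpha> \<omega> = (\<lambda>(t, s).
     ((LBINT y=ereal s0..ereal s. velocity I2 \<omega> y * cnj (\<omega> y))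
        - (LBINT x=ereal t0..ereal t. velocity I1 \<alpha> x * cnj (\<alpha> x)),
      \<alpha> t * \<omega> s))"

end

theory Submission
  imports Defs
begin

text \<open>
  The coordinate fields \<open>\<Phi>\<^sub>t = \<alpha>' (-cnj \<alpha>, \<omega>)\<close> and \<open>\<Phi>\<^sub>s = \<omega>' (cnj \<omega>, \<alpha>)\<close> are complex
  multiples of Hermitian-orthogonal vectors of squared length \<open>\<bar>\<alpha>\<bar>\<^sup>2 + \<bar>\<omega>\<bar>\<^sup>2\<close>.  Hence the surface
  is Lagrangian and \<open>J \<Phi>\<^sub>t\<close>, \<open>J \<Phi>\<^sub>s\<close> form an orthogonal frame of the normal space, so that
  everything is read off from the products of the second derivatives with this frame.  The curvatures
  enter through \<open>\<bar>\<gamma>'\<bar>\<^sup>3 \<kappa> = Im (\<gamma>'' cnj \<gamma>')\<close>.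
\<close>

section \<open>Differentiable functions of class \<open>Ck_on\<close>\<close>

lemma Ck_on_cong:
  assumes "Ck_on k S f" "\<And>x. x \<in> S \<Longrightarrow> g x = f x"
  shows "Ck_on k S g"
proof (cases k)
  case 0
  then show ?thesis using assms continuous_on_cong[OF refl, of S g f] by simp
next
  case (Suc n)
  with assms(1) obtain f' where "\<forall>x\<in>S. (f has_derivative f' x) (at x within S)"
      "\<forall>v. Ck_on n S (\<lambda>x. f' x v)"
    by auto
  then show ?thesis
    using assms(2) Suc by (auto intro!: exI[of _ f'] intro: has_derivative_transform)
qed

text \<open>At the bottom of the induction differentiability gives continuity; above it, the same
  \<open>f'\<close> serves with its order lowered by one.\<close>

lemma Ck_on_Suc_imp: "Ck_on (Suc k) S f \<Longrightarrow> Ck_on k S f"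
proof (induction k arbitrary: f)
  case 0
  then obtain f' where "\<forall>x\<in>S. (f has_derivative f' x) (at x within S)" by auto
  then show ?case by (auto intro: has_derivative_continuous_on)
next
  case (Suc k)
  then obtain f' where "\<forall>x\<in>S. (f has_derivative f' x) (at x within S)"
      "\<forall>v. Ck_on (Suc k) S (\<lambda>x. f' x v)"
    using Ck_on.simps(2)[of "Suc k" S f] by blast
  with Suc.IH show ?case
    using Ck_on.simps(2)[of "k" S f] by blast
qed

lemma Ck_on_add: "Ck_on k S f \<Longrightarrow> Ck_on k S g \<Longrightarrow> Ck_on k S (\<lambda>x. f x + g x)"
proof (induction k arbitrary: f g)
  case 0
  then show ?case by (auto intro: continuous_intros)
next
  case (Suc k)
  obtain f' where f': "\<forall>x\<in>S. (f has_derivative f' x) (at x within S)"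
      "\<forall>v. Ck_on k S (\<lambda>x. f' x v)"
    using Suc.prems(1) by auto
  obtain g' where g': "\<forall>x\<in>S. (g has_derivative g' x) (at x within S)"
      "\<forall>v. Ck_on k S (\<lambda>x. g' x v)"
    using Suc.prems(2) by auto
  show ?case
    unfolding Ck_on.simps
    using f' g' Suc.IH by (intro exI[of _ "\<lambda>x v. f' x v + g' x v"]) (auto intro!: has_derivative_add)
qed

lemma Ck_on_bounded_linear:
  assumes L: "bounded_linear L"
  shows "Ck_on k S f \<Longrightarrow> Ck_on k S (\<lambda>x. L (f x))"
proof (induction k arbitrary: f)
  case 0
  then show ?case using bounded_linear.continuous_on[OF L] by auto
next
  case (Suc k)
  obtain f' where f': "\<forall>x\<in>S. (f has_derivative f' x) (at x within S)"
      "\<forall>v. Ck_on k S (\<lambda>x. f' x v)"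
    using Suc.prems(1) by auto
  show ?case
    unfolding Ck_on.simps
    using f' Suc.IH
    by (intro exI[of _ "\<lambda>x v. L (f' x v)"]) (auto intro!: bounded_linear.has_derivative[OF L])
qed

text \<open>The product rule leaves one factor undifferentiated in each summand. That factor has
  order \<open>Suc k\<close> and is lowered to \<open>k\<close> before the induction hypothesis
  applies.\<close>

lemma Ck_on_bilinear:
  assumes B: "bounded_bilinear B"
  shows "Ck_on k S f \<Longrightarrow> Ck_on k S g \<Longrightarrow> Ck_on k S (\<lambda>x. B (f x) (g x))"
proof (induction k arbitrary: f g)
  case 0
  then show ?case using bounded_bilinear.continuous_on[OF B] by auto
next
  case (Suc k)
  obtain f' where f': "\<forall>x\<in>S. (f has_derivative f' x) (at x within S)"
      "\<forall>v. Ck_on k S (\<lambda>x. f' x v)"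
    using Suc.prems(1) by auto
  obtain g' where g': "\<forall>x\<in>S. (g has_derivative g' x) (at x within S)"
      "\<forall>v. Ck_on k S (\<lambda>x. g' x v)"
    using Suc.prems(2) by auto
  show ?case
    unfolding Ck_on.simps
    using f' g' Suc.IH Suc.prems[THEN Ck_on_Suc_imp]
    by (intro exI[of _ "\<lambda>x v. B (f x) (g' x v) + B (f' x v) (g x)"])
      (auto intro!: bounded_bilinear.FDERIV[OF B] Ck_on_add)
qed

text \<open>A linear inner map keeps the induction closed: for fixed \<open>v\<close>,
  \<open>f' (L x) (L v)\<close> is again a function composed with \<open>L\<close>. With
  \<open>fst\<close> and \<open>snd\<close> as \<open>L\<close>, functions of one parameter are
  pulled back to the rectangle.\<close>

lemma Ck_on_compose_bounded_linear:
  assumes L: "bounded_linear L" and sub: "L ` T \<subseteq> S"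
  shows "Ck_on k S f \<Longrightarrow> Ck_on k T (\<lambda>x. f (L x))"
proof (induction k arbitrary: f)
  case 0
  then show ?case
    using sub continuous_on_compose2[of S f T L] linear_continuous_on[OF L] by auto
next
  case (Suc k)
  obtain f' where f': "\<forall>x\<in>S. (f has_derivative f' x) (at x within S)"
      "\<forall>v. Ck_on k S (\<lambda>x. f' x v)"
    using Suc.prems(1) by auto
  have "((\<lambda>x. f (L x)) has_derivative (\<lambda>v. f' (L x) (L v))) (at x within T)" if "x \<in> T" for x
    using f'(1) sub that bounded_linear_imp_has_derivative[OF L]
    by (intro has_derivative_in_compose2[of S f f' L T]) auto
  then show ?case
    unfolding Ck_on.simps
    using f'(2) Suc.IH by (intro exI[of _ "\<lambda>x v. f' (L x) (L v)"]) auto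
qed

lemma Ck_on_Pair:
  assumes "Ck_on k S f" "Ck_on k S g"
  shows "Ck_on k S (\<lambda>x. (f x, g x))"
proof -
  have "bounded_linear (\<lambda>a. (a, 0))" "bounded_linear (\<lambda>b. (0, b))"
    by (auto intro!: bounded_linear_intros)
  from Ck_on_add[OF Ck_on_bounded_linear[OF this(1) assms(1)] Ck_on_bounded_linear[OF this(2) assms(2)]]
  show ?thesis by simp
qed

lemma smooth_times_cnj:
  fixes f g :: "real \<Rightarrow> complex"
  assumes "smooth_on I f" "smooth_on I g"
  shows "smooth_on I (\<lambda>x. f x * cnj (g x))"
  using assms unfolding smooth_on_def
  by (intro allI Ck_on_bilinear[OF bounded_bilinear_mult] Ck_on_bounded_linear[OF bounded_linear_cnj]) auto

text \<open>The directional derivatives of \<open>f\<close> are constant multiples of the smooth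
  \<open>g\<close>. This will handle the two integrals in the surface.\<close>

lemma Ck_on_antiderivative:
  assumes d: "\<And>t. t \<in> I \<Longrightarrow> (f has_vector_derivative g t) (at t within I)" and g: "smooth_on I g"
  shows "Ck_on k I f"
proof -
  have "Ck_on (Suc k) I f"
    unfolding Ck_on.simps
  proof (intro exI[of _ "\<lambda>t v. v *\<^sub>R g t"] conjI ballI allI)
    show "(f has_derivative (\<lambda>v. v *\<^sub>R g t)) (at t within I)" if "t \<in> I" for t
      using d[OF that] by (simp add: has_vector_derivative_def)
    show "Ck_on k I (\<lambda>t. v *\<^sub>R g t)" for v
      using Ck_on_bounded_linear[OF bounded_linear_scaleR_right] g
      unfolding smooth_on_def by blast
  qed
  then show ?thesis by (rule Ck_on_Suc_imp)
qed

section \<open>Derivatives on intervals and rectangles\<close>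

text \<open>A connected set with more than one point has no isolated points. Derivatives within the
  interval are therefore unique at its endpoints too.\<close>

lemma at_within_interval_neq_bot:
  fixes I :: "real set"
  assumes "is_interval I" "interior I \<noteq> {}" "t \<in> I"
  shows "at t within I \<noteq> bot"
proof -
  have "connected I" using assms(1) by (simp add: is_interval_connected)
  moreover have "I \<noteq> {t}" using assms(2) by auto
  ultimately show ?thesis
    using assms(3) connected_imp_perfect trivial_limit_within by blast
qed

lemma interval_nearby_point:
  fixes I :: "real set"
  assumes "is_interval I" "interior I \<noteq> {}" "t \<in> I" "0 < e"
  obtains d where "0 < \<bar>d\<bar>" "\<bar>d\<bar> < e" "t + d \<in> I"
proof -
  have "t islimpt I"
    using at_within_interval_neq_bot[OF assms(1-3)] by (simp add: trivial_limit_within)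
  then obtain x where "x \<in> I" "x \<noteq> t" "dist x t < e"
    using assms(4) unfolding islimpt_approachable by blast
  then show thesis by (intro that[of "x - t"]) (auto simp: dist_real_def)
qed

lemma smooth_on_velocity:
  assumes I: "is_interval I" "interior I \<noteq> {}" and f: "smooth_on I f"
  shows "\<And>t. t \<in> I \<Longrightarrow> (f has_vector_derivative vector_derivative f (at t within I)) (at t within I)"
    and "smooth_on I (\<lambda>t. vector_derivative f (at t within I))"
proof -
  have *: "(f has_vector_derivative vector_derivative f (at t within I)) (at t within I)"
    if "t \<in> I" for t
  proof -
    have "Ck_on (Suc 0) I f" using f unfolding smooth_on_def by blast
    then have "f differentiable (at t within I)"
      using that unfolding differentiable_def by auto
    then show ?thesis by (simp add: vector_derivative_works)
  qed
  then show "\<And>t. t \<in> I \<Longrightarrow> (f has_vector_derivative vector_derivative f (at t within I)) (at t within I)" .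
  have "Ck_on k I (\<lambda>t. vector_derivative f (at t within I))" for k
  proof -
    have "Ck_on (Suc k) I f" using f unfolding smooth_on_def by blast
    then obtain f' where f': "\<forall>x\<in>I. (f has_derivative f' x) (at x within I)"
        "\<forall>v. Ck_on k I (\<lambda>x. f' x v)"
      by auto
    \<comment> \<open>The witness \<open>f'\<close> may vary with \<open>k\<close>; uniqueness of
      the derivative ties every such witness to the one function
      \<open>vector_derivative f\<close>.\<close>
    have "vector_derivative f (at t within I) = f' t 1" if "t \<in> I" for t
    proof (rule vector_derivative_within)
      show "at t within I \<noteq> bot" using I that by (rule at_within_interval_neq_bot)
      have "(f has_derivative f' t) (at t within I)" using f'(1) that by blast
      moreover from this have "linear (f' t)" by (rule has_derivative_linear)
      then have "f' t = (\<lambda>x. x *\<^sub>R f' t 1)"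
        by (metis linear_scale mult.right_neutral real_scaleR_def)
      ultimately show "(f has_vector_derivative f' t 1) (at t within I)"
        unfolding has_vector_derivative_def by metis
    qed
    with f'(2) show ?thesis by (auto intro: Ck_on_cong)
  qed
  then show "smooth_on I (\<lambda>t. vector_derivative f (at t within I))" by (simp add: smooth_on_def)
qed

lemma smooth_on_continuous: "smooth_on S f \<Longrightarrow> continuous_on S f"
  unfolding smooth_on_def using Ck_on.simps(1) by blast

text \<open>The fundamental theorem is applied on a compact subinterval \<open>{a..b}\<close> that
  contains \<open>c\<close> and \<open>x\<close> and coincides with \<open>I\<close> near
  \<open>x\<close>. This covers open, closed and unbounded intervals alike.\<close>

lemma interval_integral_has_vector_derivative:
  fixes f :: "real \<Rightarrow> 'a::euclidean_space"
  assumes I: "is_interval I" and c: "c \<in> I" and x: "x \<in> I" and f: "continuous_on I f"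
  shows "((\<lambda>u. LBINT y=ereal c..ereal u. f y) has_vector_derivative f x) (at x within I)"
proof -
  \<comment> \<open>If no point of \<open>I\<close> lies to the left of both \<open>c\<close> and
    \<open>x\<close>, then \<open>min c x\<close> is itself the left endpoint of
    \<open>I\<close>.\<close>
  obtain a where a: "a \<in> I" "a \<le> min c x" "a < min c x \<or> (\<forall>y\<in>I. a \<le> y)"
  proof (cases "\<exists>y\<in>I. y < min c x")
    case True
    then obtain y where "y \<in> I" "y < min c x" by blast
    then show thesis by (intro that[of y]) auto
  next
    case False
    with c x show thesis by (intro that[of "min c x"]) (auto simp: min_def not_less)
  qed
  obtain b where b: "b \<in> I" "max c x \<le> b" "max c x < b \<or> (\<forall>y\<in>I. y \<le> b)"
  proof (cases "\<exists>y\<in>I. max c x < y")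
    case True
    then obtain y where "y \<in> I" "max c x < y" by blast
    then show thesis by (intro that[of y]) auto
  next
    case False
    with c x show thesis by (intro that[of "max c x"]) (auto simp: max_def not_less)
  qed
  have sub: "{a..b} \<subseteq> I"
    using I a(1) b(1) unfolding is_interval_1 by (meson atLeastAtMost_iff subsetI)
  have "((\<lambda>u. LBINT y=ereal c..ereal u. f y) has_vector_derivative f x) (at x within {a..b})"
    using a(2) b(2) continuous_on_subset[OF f sub] by (intro interval_integral_FTC2) auto
  \<comment> \<open>The window from \<open>l\<close> to \<open>h\<close> excludes the region where
    \<open>{a..b}\<close> may stop short of \<open>I\<close>. If \<open>a = x\<close>, then
    \<open>x\<close> is the least point of \<open>I\<close> and any bound below \<open>x\<close>
    will do; the right side is symmetric.\<close>
  moreover define l where "l = (if a < x then a else x - 1)"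
  define h where "h = (if x < b then b else x + 1)"
  have "at x within {a..b} = at x within I"
  proof (rule at_within_nhd)
    show "x \<in> {l<..<h}" by (auto simp: l_def h_def)
    show "{a..b} \<inter> {l<..<h} - {x} = I \<inter> {l<..<h} - {x}"
      using sub a b x by (force simp: l_def h_def split: if_splits)
  qed simp
  ultimately show ?thesis by simp
qed

text \<open>The derivative within a set is unique once every coordinate direction admits arbitrarily
  small displacements inside the set. Nondegenerate intervals supply them even at edges and corners
  of the rectangle.\<close>

lemma frechet_derivative_rectangle:
  fixes I1 I2 :: "real set"
  assumes "is_interval I1" "interior I1 \<noteq> {}" "is_interval I2" "interior I2 \<noteq> {}"
    and "t \<in> I1" "s \<in> I2"
    and "(f has_derivative D) (at (t, s) within I1 \<times> I2)"
  shows "frechet_derivative f (at (t, s) within I1 \<times> I2) = D"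
proof (rule frechet_derivative_unique_within[symmetric, OF assms(7)])
  show "(f has_derivative frechet_derivative f (at (t, s) within I1 \<times> I2)) (at (t, s) within I1 \<times> I2)"
    using assms(7) frechet_derivative_works differentiable_def by blast
  fix i :: "real \<times> real" and e :: real
  assume i: "i \<in> Basis" and e: "0 < e"
  obtain d1 where "0 < \<bar>d1\<bar>" "\<bar>d1\<bar> < e" "t + d1 \<in> I1"
    using interval_nearby_point[OF assms(1,2,5) e] .
  moreover obtain d2 where "0 < \<bar>d2\<bar>" "\<bar>d2\<bar> < e" "s + d2 \<in> I2"
    using interval_nearby_point[OF assms(3,4,6) e] .
  ultimately show "\<exists>d. 0 < \<bar>d\<bar> \<and> \<bar>d\<bar> < e \<and> (t, s) + d *\<^sub>R i \<in> I1 \<times> I2"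
    using i assms(5,6) by (auto simp: Basis_prod_def)
qed

section \<open>The curvature of a planar curve\<close>

text \<open>Both \<open>cis \<theta>\<close> and \<open>cis \<eta>\<close> equal \<open>f\<close>
  divided by its modulus, so they agree on \<open>I\<close>. Comparing their derivatives at
  \<open>t\<close> yields the claim.\<close>

lemma continuous_arg_derivative_unique:
  fixes f :: "real \<Rightarrow> complex"
  assumes I: "at t within I \<noteq> bot" and t: "t \<in> I" and nz: "\<And>x. x \<in> I \<Longrightarrow> f x \<noteq> 0"
    and \<theta>: "continuous_arg_on I f \<theta>" "(\<theta> has_real_derivative a) (at t within I)"
    and \<eta>: "continuous_arg_on I f \<eta>" "(\<eta> has_real_derivative b) (at t within I)"
  shows "a = b"
proof -
  have cis_deriv: "((\<lambda>x. cis (\<theta> x)) has_vector_derivative a *\<^sub>R (\<i> * cis (\<theta> t))) (at t within I)"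
    if "(\<theta> has_real_derivative a) (at t within I)" for \<theta> a
    using that unfolding has_vector_derivative_def has_field_derivative_def
    by (auto intro!: derivative_eq_intros simp: fun_eq_iff mult.commute)
  have eq: "cis (\<theta> x) = cis (\<eta> x)" if "x \<in> I" for x
    using \<theta>(1) \<eta>(1) nz[OF that] that unfolding continuous_arg_on_def
    by (metis mult_left_cancel norm_eq_zero of_real_eq_0_iff)
  have "((\<lambda>x. cis (\<theta> x)) has_vector_derivative b *\<^sub>R (\<i> * cis (\<eta> t))) (at t within I)"
    using cis_deriv[OF \<eta>(2)] t eq has_vector_derivative_transform by metis
  then have "a *\<^sub>R (\<i> * cis (\<theta> t)) = b *\<^sub>R (\<i> * cis (\<eta> t))"
    using vector_derivative_unique_within[OF I cis_deriv[OF \<theta>(2)]] by blast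
  then show ?thesis using eq[OF t] by simp
qed

text \<open>The lift comes from a logarithm: \<open>F\<close> is an antiderivative of
  \<open>f' / f\<close>, so \<open>f * exp (- F)\<close> is constant, and the imaginary part of
  \<open>F\<close> is an argument of \<open>f\<close> up to a constant.\<close>

lemma continuous_arg_exists:
  fixes f :: "real \<Rightarrow> complex"
  assumes I: "is_interval I" and c: "c \<in> I" and nz: "\<And>x. x \<in> I \<Longrightarrow> f x \<noteq> 0"
    and f': "\<And>x. x \<in> I \<Longrightarrow> (f has_vector_derivative f' x) (at x within I)" "continuous_on I f'"
  obtains \<theta> where "continuous_arg_on I f \<theta>"
    "\<And>x. x \<in> I \<Longrightarrow> (\<theta> has_real_derivative Im (f' x / f x)) (at x within I)"
proof -
  define F where "F u = (LBINT y=ereal c..ereal u. f' y / f y)" for u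
  have "continuous_on I f"
    using f'(1) continuous_on_eq_continuous_within has_vector_derivative_continuous by blast
  then have "continuous_on I (\<lambda>x. f' x / f x)"
    using f'(2) nz by (intro continuous_intros) auto
  then have F: "(F has_vector_derivative f' x / f x) (at x within I)" if "x \<in> I" for x
    using interval_integral_has_vector_derivative[OF I c that] unfolding F_def by blast
  have "\<exists>k. \<forall>x\<in>I. f x * exp (- F x) = k"
  proof (rule has_derivative_zero_constant)
    show "convex I" using I by (rule is_interval_convex)
    show "((\<lambda>x. f x * exp (- F x)) has_derivative (\<lambda>h. 0)) (at x within I)" if "x \<in> I" for x
    proof -
      have "((\<lambda>z. exp (- z)) \<circ> F has_vector_derivative f' x / f x * - exp (- F x)) (at x within I)"
        using F[OF that]
        by (rule field_vector_diff_chain_within) (auto intro!: derivative_eq_intros)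
      from has_vector_derivative_mult[OF f'(1)[OF that] this] show ?thesis
        using nz[OF that] by (simp add: has_vector_derivative_def o_def)
    qed
  qed
  then obtain k where "\<And>x. x \<in> I \<Longrightarrow> f x * exp (- F x) = k" by blast
  then have k: "f x = k * exp (F x)" if "x \<in> I" for x
    using that by (force simp: exp_minus field_simps)
  \<comment> \<open>In \<open>f = k * exp F\<close> the arguments of the two factors add up;
    \<open>Re F\<close> affects only the modulus.\<close>
  define \<theta> where "\<theta> x = Arg k + Im (F x)" for x
  have \<theta>: "(\<theta> has_real_derivative Im (f' x / f x)) (at x within I)" if "x \<in> I" for x
  proof -
    have "((\<lambda>x. Im (F x)) has_real_derivative Im (f' x / f x)) (at x within I)"
      using bounded_linear.has_vector_derivative[OF bounded_linear_Im F[OF that]]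
      unfolding has_real_derivative_iff_has_vector_derivative .
    from DERIV_add[OF DERIV_const this] show ?thesis unfolding \<theta>_def by simp
  qed
  moreover have "continuous_arg_on I f \<theta>"
    unfolding continuous_arg_on_def
  proof (intro conjI ballI)
    show "continuous_on I \<theta>"
      by (rule DERIV_continuous_on[OF \<theta>])
    fix x assume x: "x \<in> I"
    have "k * exp (F x) = (cmod k * cis (Arg k)) * (exp (Re (F x)) * cis (Im (F x)))"
      using rcis_cmod_Arg[of k] by (simp add: rcis_def exp_eq_polar[of "F x"])
    also have "\<dots> = complex_of_real (cmod (k * exp (F x))) * cis (\<theta> x)"
      by (simp add: \<theta>_def norm_mult mult_ac flip: cis_mult)
    finally show "f x = complex_of_real (cmod (f x)) * cis (\<theta> x)"
      by (simp add: k[OF x])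
  qed
  ultimately show thesis by (rule that[rotated])
qed

text \<open>The argument of the velocity turns at the rate given by the imaginary part of its
  logarithmic derivative. Existence and uniqueness of that rate discharge the \<open>THE\<close> in
  the definition.\<close>

lemma signed_curvature_eq:
  fixes \<gamma> :: "real \<Rightarrow> complex"
  assumes I: "is_interval I" "interior I \<noteq> {}" and t: "t \<in> I" and \<gamma>: "regular_curve_on I \<gamma>"
  shows "cmod (velocity I \<gamma> t) * signed_curvature I \<gamma> t
    = Im (velocity I (velocity I \<gamma>) t / velocity I \<gamma> t)"
proof -
  have sm: "smooth_on I \<gamma>" and nz: "\<And>x. x \<in> I \<Longrightarrow> velocity I \<gamma> x \<noteq> 0"
    using \<gamma> by (auto simp: regular_curve_on_def)
  note v = smooth_on_velocity(2)[OF I sm]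
  obtain \<theta> where \<theta>: "continuous_arg_on I (velocity I \<gamma>) \<theta>"
    "(\<theta> has_real_derivative Im (velocity I (velocity I \<gamma>) t / velocity I \<gamma> t)) (at t within I)"
    using continuous_arg_exists[OF I(1) t nz smooth_on_velocity(1)[OF I v]
        smooth_on_continuous[OF smooth_on_velocity(2)[OF I v]]] t by metis
  define \<kappa> where "\<kappa> = Im (velocity I (velocity I \<gamma>) t / velocity I \<gamma> t) / cmod (velocity I \<gamma> t)"
  have k: "cmod (velocity I \<gamma> t) * \<kappa> = Im (velocity I (velocity I \<gamma>) t / velocity I \<gamma> t)"
    using nz[OF t] by (simp add: \<kappa>_def)
  have "signed_curvature I \<gamma> t = \<kappa>"
    unfolding signed_curvature_def
  proof (rule the_equality)
    show "\<exists>\<theta>. continuous_arg_on I (velocity I \<gamma>) \<theta> \<and>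
        (\<theta> has_real_derivative cmod (velocity I \<gamma> t) * \<kappa>) (at t within I)"
      using \<theta> k by auto
    fix \<kappa>' assume "\<exists>\<theta>. continuous_arg_on I (velocity I \<gamma>) \<theta> \<and>
        (\<theta> has_real_derivative cmod (velocity I \<gamma> t) * \<kappa>') (at t within I)"
    then have "cmod (velocity I \<gamma> t) * \<kappa>' = cmod (velocity I \<gamma> t) * \<kappa>"
      using continuous_arg_derivative_unique[OF at_within_interval_neq_bot[OF I t] t nz _ _ \<theta>] k by metis
    then show "\<kappa>' = \<kappa>" using nz[OF t] by simp
  qed
  then show ?thesis using k by simp
qed

section \<open>Hermitian-orthogonal frames\<close>

lemma J_add: "J (z + w) = J z + J w" and J_scaleR: "J (c *\<^sub>R z) = c *\<^sub>R J z"
  by (simp_all add: J_def prod_eq_iff algebra_simps)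

lemma J_inner_J: "J z \<bullet> J w = z \<bullet> w"
  by (simp add: J_def inner_prod_def inner_complex_def algebra_simps)

text \<open>The two inner products are the real and imaginary parts of the Hermitian
  product.\<close>

lemma hermitian_eq_0_imp_inner:
  assumes "hermitian X Y = 0"
  shows "X \<bullet> Y = 0" "X \<bullet> J Y = 0"
  using assms by (auto simp: hermitian_def J_def inner_prod_def inner_complex_def complex_eq_iff)

lemma hermitian_eq_0_sym: "hermitian X Y = 0 \<Longrightarrow> hermitian Y X = 0"
  by (simp add: hermitian_def complex_eq_iff algebra_simps)

lemma inner_J_self: "X \<bullet> J X = 0"
  by (simp add: J_def inner_prod_def inner_complex_def algebra_simps)

text \<open>\<open>X\<close> and \<open>Y\<close> form a complex basis. Real parts of the
  coefficients go with \<open>X\<close>, \<open>Y\<close> and imaginary parts with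
  \<open>J X\<close>, \<open>J Y\<close>; orthogonality of these four vectors identifies the
  imaginary parts as projections.\<close>

lemma J_frame_decomposition:
  assumes "hermitian X Y = 0" "dz1_wedge_dz2 X Y \<noteq> 0"
  obtains a b where
    "w = a *\<^sub>R X + b *\<^sub>R Y + (w \<bullet> J X / (X \<bullet> X)) *\<^sub>R J X + (w \<bullet> J Y / (Y \<bullet> Y)) *\<^sub>R J Y"
proof -
  \<comment> \<open>Cramer's rule for the complex coordinates of \<open>w\<close> with respect to
    \<open>X\<close> and \<open>Y\<close>.\<close>
  define a where "a = dz1_wedge_dz2 w Y / dz1_wedge_dz2 X Y"
  define b where "b = dz1_wedge_dz2 X w / dz1_wedge_dz2 X Y"
  have "a * fst X + b * fst Y = (dz1_wedge_dz2 w Y * fst X + dz1_wedge_dz2 X w * fst Y) / dz1_wedge_dz2 X Y"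
       "a * snd X + b * snd Y = (dz1_wedge_dz2 w Y * snd X + dz1_wedge_dz2 X w * snd Y) / dz1_wedge_dz2 X Y"
    by (simp_all add: a_def b_def add_divide_distrib)
  moreover have "dz1_wedge_dz2 w Y * fst X + dz1_wedge_dz2 X w * fst Y = fst w * dz1_wedge_dz2 X Y"
    "dz1_wedge_dz2 w Y * snd X + dz1_wedge_dz2 X w * snd Y = snd w * dz1_wedge_dz2 X Y"
    by (simp_all add: dz1_wedge_dz2_def algebra_simps)
  ultimately have "w = (a * fst X + b * fst Y, a * snd X + b * snd Y)"
    using assms(2) by (simp add: prod_eq_iff)
  then have w: "w = Re a *\<^sub>R X + Re b *\<^sub>R Y + Im a *\<^sub>R J X + Im b *\<^sub>R J Y"
    by (simp add: J_def prod_eq_iff complex_eq_iff algebra_simps)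
  have "X \<noteq> 0" "Y \<noteq> 0" using assms(2) by (auto simp: dz1_wedge_dz2_def)
  moreover have "w \<bullet> J X = Im a * (X \<bullet> X)" "w \<bullet> J Y = Im b * (Y \<bullet> Y)"
    using hermitian_eq_0_imp_inner[OF assms(1)]
      hermitian_eq_0_imp_inner[OF hermitian_eq_0_sym[OF assms(1)]]
    by (simp_all add: w inner_add_left J_inner_J inner_J_self)
  ultimately show thesis
    using w by (intro that[of "Re a" "Re b"]) simp
qed

text \<open>The \<open>J X\<close>, \<open>J Y\<close> part of the decomposition is normal and what
  remains is tangent. A second candidate differs from it by a vector that is both tangent and
  normal, hence zero.\<close>

lemma normal_component_frame:
  assumes XY: "hermitian X Y = 0" "dz1_wedge_dz2 X Y \<noteq> 0"
  shows "normal_component (range (\<lambda>h. fst h *\<^sub>R X + snd h *\<^sub>R Y)) w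
    = (w \<bullet> J X / (X \<bullet> X)) *\<^sub>R J X + (w \<bullet> J Y / (Y \<bullet> Y)) *\<^sub>R J Y"
    (is "normal_component ?T w = ?n")
  unfolding normal_component_def
proof (rule the_equality)
  have T: "c *\<^sub>R X + d *\<^sub>R Y \<in> ?T" for c d
    by (rule range_eqI[of _ _ "(c, d)"]) simp
  have n: "?n \<bullet> x = 0" if "x \<in> ?T" for x
    using that hermitian_eq_0_imp_inner[OF XY(1)]
      hermitian_eq_0_imp_inner[OF hermitian_eq_0_sym[OF XY(1)]]
    by (auto simp: inner_add_left inner_add_right inner_J_self inner_commute[of "J _"])
  obtain a b where ab: "w = a *\<^sub>R X + b *\<^sub>R Y + (w \<bullet> J X / (X \<bullet> X)) *\<^sub>R J X + (w \<bullet> J Y / (Y \<bullet> Y)) *\<^sub>R J Y"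
    using J_frame_decomposition[OF XY] .
  have wn: "w - ?n = a *\<^sub>R X + b *\<^sub>R Y"
    by (subst ab) (simp add: algebra_simps)
  show "(\<forall>x\<in>?T. ?n \<bullet> x = 0) \<and> w - ?n \<in> ?T"
    using n T unfolding wn by blast
  fix n' assume n': "(\<forall>x\<in>?T. n' \<bullet> x = 0) \<and> w - n' \<in> ?T"
  then obtain c d where cd: "w - n' = c *\<^sub>R X + d *\<^sub>R Y" by auto
  have "n' - ?n = (w - ?n) - (w - n')" by simp
  also have "\<dots> = (a - c) *\<^sub>R X + (b - d) *\<^sub>R Y"
    unfolding wn cd by (simp add: scaleR_diff_left)
  finally have "n' - ?n = (a - c) *\<^sub>R X + (b - d) *\<^sub>R Y" .
  then have "n' - ?n \<in> ?T" by (simp only: T)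
  then have "n' \<bullet> (n' - ?n) = 0" "?n \<bullet> (n' - ?n) = 0"
    using n' n by blast+
  then have "(n' - ?n) \<bullet> (n' - ?n) = 0"
    by (simp only: inner_diff_left[of n' ?n])
  then show "n' = ?n" by simp
qed

section \<open>The product surface\<close>

lemma has_derivative_fst_rectangle:
  assumes "(f has_vector_derivative f') (at t within A)"
  shows "((\<lambda>p. f (fst p)) has_derivative (\<lambda>h. fst h *\<^sub>R f')) (at (t, s) within A \<times> B)"
proof -
  \<comment> \<open>The first projection of the product is \<open>A\<close>, or empty when
    \<open>B\<close> is; restriction to a subset covers both cases.\<close>
  have "(f has_derivative (\<lambda>h. h *\<^sub>R f')) (at (fst (t, s)) within fst ` (A \<times> B))"
    using assms unfolding has_vector_derivative_def
    by (auto intro: has_derivative_subset)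
  with has_derivative_in_compose[OF has_derivative_fst[OF has_derivative_ident]]
  show ?thesis by fastforce
qed

lemma has_derivative_snd_rectangle:
  assumes "(f has_vector_derivative f') (at s within B)"
  shows "((\<lambda>p. f (snd p)) has_derivative (\<lambda>h. snd h *\<^sub>R f')) (at (t, s) within A \<times> B)"
proof -
  have "(f has_derivative (\<lambda>h. h *\<^sub>R f')) (at (snd (t, s)) within snd ` (A \<times> B))"
    using assms unfolding has_vector_derivative_def
    by (auto intro: has_derivative_subset)
  with has_derivative_in_compose[OF has_derivative_snd[OF has_derivative_ident]]
  show ?thesis by fastforce
qed

locale curve_pair =
  fixes I1 I2 :: "real set" and \<alpha> \<omega> :: "real \<Rightarrow> complex" and t0 s0 :: real
  assumes I1: "is_interval I1" "interior I1 \<noteq> {}"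
    and I2: "is_interval I2" "interior I2 \<noteq> {}"
    and \<alpha>: "regular_curve_on I1 \<alpha>" and \<alpha>_nz: "\<forall>t\<in>I1. \<alpha> t \<noteq> 0"
    and \<omega>: "regular_curve_on I2 \<omega>" and \<omega>_nz: "\<forall>s\<in>I2. \<omega> s \<noteq> 0"
    and t0: "t0 \<in> I1" and s0: "s0 \<in> I2"
begin

definition "U = I1 \<times> I2"
definition "\<Phi> = curve_product I1 I2 t0 s0 \<alpha> \<omega>"
abbreviation "\<alpha>' \<equiv> velocity I1 \<alpha>"
abbreviation "\<omega>' \<equiv> velocity I2 \<omega>"
abbreviation "\<alpha>'' \<equiv> velocity I1 \<alpha>'"
abbreviation "\<omega>'' \<equiv> velocity I2 \<omega>'"
text \<open>The conformal factor of the induced metric.\<close>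

definition "r t s = (cmod (\<alpha> t))\<^sup>2 + (cmod (\<omega> s))\<^sup>2"

text \<open>These five are the first and second partial derivatives of \<open>\<Phi>\<close> in
  closed form. The mixed one has first component 0, since the first component of
  \<open>\<Phi>\<close> is a function of \<open>s\<close> minus a function of
  \<open>t\<close>.\<close>

definition "\<Phi>t p = (- (\<alpha>' (fst p) * cnj (\<alpha> (fst p))), \<alpha>' (fst p) * \<omega> (snd p))"
definition "\<Phi>s p = (\<omega>' (snd p) * cnj (\<omega> (snd p)), \<alpha> (fst p) * \<omega>' (snd p))"
definition "\<Phi>tt p = (- (\<alpha>'' (fst p) * cnj (\<alpha> (fst p)) + \<alpha>' (fst p) * cnj (\<alpha>' (fst p))),
  \<alpha>'' (fst p) * \<omega> (snd p))"
definition "\<Phi>ts p = (0 :: complex, \<alpha>' (fst p) * \<omega>' (snd p))"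
definition "\<Phi>ss p = (\<omega>'' (snd p) * cnj (\<omega> (snd p)) + \<omega>' (snd p) * cnj (\<omega>' (snd p)),
  \<alpha> (fst p) * \<omega>'' (snd p))"

section \<open>Smoothness and the first and second derivatives of the surface\<close>

lemma smooth_\<alpha>: "smooth_on I1 \<alpha>" "smooth_on I1 \<alpha>'"
  using \<alpha> by (auto simp: regular_curve_on_def intro!: smooth_on_velocity(2)[OF I1])

lemma smooth_\<omega>: "smooth_on I2 \<omega>" "smooth_on I2 \<omega>'"
  using \<omega> by (auto simp: regular_curve_on_def intro!: smooth_on_velocity(2)[OF I2])

lemma velocity_nz: "t \<in> I1 \<Longrightarrow> \<alpha>' t \<noteq> 0" "s \<in> I2 \<Longrightarrow> \<omega>' s \<noteq> 0"
  using \<alpha> \<omega> by (auto simp: regular_curve_on_def)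

lemma r_pos: "t \<in> I1 \<Longrightarrow> 0 < r t s"
  using \<alpha>_nz by (auto simp: r_def intro: add_pos_nonneg)

lemma \<Phi>_eq: "\<Phi> = (\<lambda>p.
    ((LBINT y=ereal s0..ereal (snd p). \<omega>' y * cnj (\<omega> y)) - (LBINT x=ereal t0..ereal (fst p). \<alpha>' x * cnj (\<alpha> x)),
     \<alpha> (fst p) * \<omega> (snd p)))"
  by (simp add: \<Phi>_def curve_product_def case_prod_beta' fun_eq_iff)

lemma integral_derivatives:
  "t \<in> I1 \<Longrightarrow> ((\<lambda>t. LBINT x=ereal t0..ereal t. \<alpha>' x * cnj (\<alpha> x)) has_vector_derivative \<alpha>' t * cnj (\<alpha> t)) (at t within I1)"
  "s \<in> I2 \<Longrightarrow> ((\<lambda>s. LBINT y=ereal s0..ereal s. \<omega>' y * cnj (\<omega> y)) has_vector_derivative \<omega>' s * cnj (\<omega> s)) (at s within I2)"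
  by (rule interval_integral_has_vector_derivative[OF I1(1) t0 _ smooth_on_continuous[OF smooth_times_cnj[OF smooth_\<alpha>(2,1)]]],
      assumption)
    (rule interval_integral_has_vector_derivative[OF I2(1) s0 _ smooth_on_continuous[OF smooth_times_cnj[OF smooth_\<omega>(2,1)]]],
      assumption)

lemma smooth_\<Phi>: "smooth_on U \<Phi>"
  unfolding smooth_on_def
proof
  fix k
  note t = Ck_on_compose_bounded_linear[OF bounded_linear_fst, of U I1 k]
  note s = Ck_on_compose_bounded_linear[OF bounded_linear_snd, of U I2 k]
  have U: "fst ` U \<subseteq> I1" "snd ` U \<subseteq> I2" by (auto simp: U_def)
  have a: "Ck_on k I1 (\<lambda>t. LBINT x=ereal t0..ereal t. \<alpha>' x * cnj (\<alpha> x))"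
    by (rule Ck_on_antiderivative[OF integral_derivatives(1) smooth_times_cnj[OF smooth_\<alpha>(2,1)]])
  have b: "Ck_on k I2 (\<lambda>s. LBINT y=ereal s0..ereal s. \<omega>' y * cnj (\<omega> y))"
    by (rule Ck_on_antiderivative[OF integral_derivatives(2) smooth_times_cnj[OF smooth_\<omega>(2,1)]])
  have "Ck_on k I1 \<alpha>" "Ck_on k I2 \<omega>"
    using smooth_\<alpha>(1) smooth_\<omega>(1) by (simp_all add: smooth_on_def)
  note c = Ck_on_bilinear[OF bounded_bilinear_mult t[OF U(1) this(1)] s[OF U(2) this(2)]]
  show "Ck_on k U \<Phi>"
    unfolding \<Phi>_eq diff_conv_add_uminus
    by (rule Ck_on_Pair[OF Ck_on_add[OF s[OF U(2) b]
          Ck_on_bounded_linear[OF bounded_linear_minus[OF bounded_linear_ident] t[OF U(1) a]]] c])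
qed

lemma has_derivative_\<Phi>:
  assumes "p \<in> U"
  shows "(\<Phi> has_derivative (\<lambda>h. fst h *\<^sub>R \<Phi>t p + snd h *\<^sub>R \<Phi>s p)) (at p within U)"
proof -
  obtain t s where p: "p = (t, s)" "t \<in> I1" "s \<in> I2" using assms by (auto simp: U_def)
  note d = has_derivative_fst_rectangle[where B=I2 and s=s, OF integral_derivatives(1)[OF p(2)]]
    has_derivative_snd_rectangle[where A=I1 and t=t, OF integral_derivatives(2)[OF p(3)]]
    has_derivative_fst_rectangle[where B=I2 and s=s, OF smooth_on_velocity(1)[OF I1 smooth_\<alpha>(1) p(2)]]
    has_derivative_snd_rectangle[where A=I1 and t=t, OF smooth_on_velocity(1)[OF I2 smooth_\<omega>(1) p(3)]]
  show ?thesis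
    unfolding p(1) U_def \<Phi>_eq
    by (rule has_derivative_eq_rhs[OF has_derivative_Pair[OF
            has_derivative_diff[OF d(2,1)] has_derivative_mult[OF d(3,4)]]])
      (auto simp: fun_eq_iff \<Phi>t_def \<Phi>s_def scaleR_conv_of_real algebra_simps)
qed

lemma differential_\<Phi>:
  assumes "p \<in> U"
  shows "differential U \<Phi> p = (\<lambda>h. fst h *\<^sub>R \<Phi>t p + snd h *\<^sub>R \<Phi>s p)"
proof -
  obtain t s where p: "p = (t, s)" "t \<in> I1" "s \<in> I2" using assms by (auto simp: U_def)
  show ?thesis
    using frechet_derivative_rectangle[OF I1 I2 p(2,3)] has_derivative_\<Phi>[OF assms]
    by (auto simp: differential_def U_def p(1))
qed

lemma second_derivative_\<Phi>:
  assumes "p \<in> U"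
  shows "frechet_derivative (\<lambda>q. differential U \<Phi> q v) (at p within U)
    = (\<lambda>u. (fst u * fst v) *\<^sub>R \<Phi>tt p + (fst u * snd v + snd u * fst v) *\<^sub>R \<Phi>ts p + (snd u * snd v) *\<^sub>R \<Phi>ss p)"
    (is "_ = ?D")
proof -
  obtain t s where p: "p = (t, s)" "t \<in> I1" "s \<in> I2" using assms by (auto simp: U_def)
  note d = has_derivative_fst_rectangle[where B=I2 and s=s, OF smooth_on_velocity(1)[OF I1 smooth_\<alpha>(1) p(2)]]
    has_derivative_snd_rectangle[where A=I1 and t=t, OF smooth_on_velocity(1)[OF I2 smooth_\<omega>(1) p(3)]]
    has_derivative_fst_rectangle[where B=I2 and s=s, OF smooth_on_velocity(1)[OF I1 smooth_\<alpha>(2) p(2)]]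
    has_derivative_snd_rectangle[where A=I1 and t=t, OF smooth_on_velocity(1)[OF I2 smooth_\<omega>(2) p(3)]]
  note cnj_d = d(1,2)[THEN bounded_linear.has_derivative[OF bounded_linear_cnj]]
  have "(\<Phi>t has_derivative (\<lambda>u. fst u *\<^sub>R \<Phi>tt p + snd u *\<^sub>R \<Phi>ts p)) (at p within U)"
    unfolding p(1) U_def \<Phi>t_def[abs_def]
    by (rule has_derivative_eq_rhs[OF has_derivative_Pair[OF has_derivative_minus[OF
              has_derivative_mult[OF d(3) cnj_d(1)]] has_derivative_mult[OF d(3,2)]]])
      (auto simp: fun_eq_iff \<Phi>tt_def \<Phi>ts_def scaleR_conv_of_real algebra_simps)
  moreover have "(\<Phi>s has_derivative (\<lambda>u. fst u *\<^sub>R \<Phi>ts p + snd u *\<^sub>R \<Phi>ss p)) (at p within U)"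
    unfolding p(1) U_def \<Phi>s_def[abs_def]
    by (rule has_derivative_eq_rhs[OF has_derivative_Pair[OF
            has_derivative_mult[OF d(4) cnj_d(2)] has_derivative_mult[OF d(1,4)]]])
      (auto simp: fun_eq_iff \<Phi>ts_def \<Phi>ss_def scaleR_conv_of_real algebra_simps)
  ultimately have "((\<lambda>q. fst v *\<^sub>R \<Phi>t q + snd v *\<^sub>R \<Phi>s q) has_derivative ?D) (at p within U)"
    by (auto intro!: has_derivative_eq_rhs[OF has_derivative_add[OF has_derivative_scaleR_right has_derivative_scaleR_right]]
        simp: fun_eq_iff algebra_simps)
  \<comment> \<open>The closed form of the differential is known on \<open>U\<close> only, which
    suffices for a derivative within \<open>U\<close>.\<close>
  then have "((\<lambda>q. differential U \<Phi> q v) has_derivative ?D) (at p within U)"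
    by (rule has_derivative_transform[OF assms, rotated]) (simp add: differential_\<Phi>)
  then show ?thesis
    using frechet_derivative_rectangle[OF I1 I2 p(2,3)] p(1) by (auto simp: U_def)
qed

section \<open>Induced metric and the Lagrangian condition\<close>

lemma hermitian_\<Phi>t_\<Phi>s: "hermitian (\<Phi>t p) (\<Phi>s p) = 0"
  by (simp add: hermitian_def \<Phi>t_def \<Phi>s_def)

text \<open>The minus sign is the source of the summand \<open>pi\<close> in the Lagrangian angle,
  and nonvanishing on \<open>U\<close> makes the coordinate fields a complex basis.\<close>

lemma dz1_wedge_dz2_\<Phi>t_\<Phi>s: "dz1_wedge_dz2 (\<Phi>t (t, s)) (\<Phi>s (t, s)) = - (\<alpha>' t * \<omega>' s * r t s)"
  by (simp add: dz1_wedge_dz2_def \<Phi>t_def \<Phi>s_def r_def complex_norm_square algebra_simps del: of_real_power)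

lemma metric_coefficients:
  "\<Phi>t (t, s) \<bullet> \<Phi>t (t, s) = r t s * (cmod (\<alpha>' t))\<^sup>2"
  "\<Phi>s (t, s) \<bullet> \<Phi>s (t, s) = r t s * (cmod (\<omega>' s))\<^sup>2"
  "\<Phi>t p \<bullet> \<Phi>s p = 0" "\<Phi>s p \<bullet> \<Phi>t p = 0"
  using hermitian_eq_0_imp_inner(1)[OF hermitian_\<Phi>t_\<Phi>s]
    hermitian_eq_0_imp_inner(1)[OF hermitian_eq_0_sym[OF hermitian_\<Phi>t_\<Phi>s]]
  by (simp_all add: \<Phi>t_def \<Phi>s_def r_def inner_prod_def dot_square_norm
      norm_mult power_mult_distrib distrib_left mult.commute add.commute)

lemma induced_metric_\<Phi>:
  assumes "(t, s) \<in> U"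
  shows "induced_metric U \<Phi> (t, s) u v =
    r t s * ((cmod (\<alpha>' t))\<^sup>2 * (fst u * fst v) + (cmod (\<omega>' s))\<^sup>2 * (snd u * snd v))"
  by (simp add: induced_metric_def differential_\<Phi>[OF assms] inner_add_left inner_add_right
      metric_coefficients algebra_simps)

lemma frame_independent:
  assumes "(t, s) \<in> U"
  shows "dz1_wedge_dz2 (\<Phi>t (t, s)) (\<Phi>s (t, s)) \<noteq> 0"
  using assms velocity_nz r_pos[of t s] by (auto simp: dz1_wedge_dz2_\<Phi>t_\<Phi>s U_def)

lemma lagrangian_\<Phi>: "lagrangian_immersion_on U \<Phi>"
proof -
  have "inj (differential U \<Phi> p)" if pU: "p \<in> U" for p
  proof -
    obtain t s where p: "p = (t, s)" "t \<in> I1" "s \<in> I2" using pU by (auto simp: U_def)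
    have "linear (differential U \<Phi> p)"
      unfolding differential_\<Phi>[OF pU] using has_derivative_\<Phi>[OF pU] has_derivative_linear by blast
    \<comment> \<open>A vector in the kernel has induced length 0, while the metric is diagonal with
      positive coefficients.\<close>
    moreover have "u = 0" if "differential U \<Phi> p u = 0" for u
    proof -
      have "0 = r t s * ((cmod (\<alpha>' t))\<^sup>2 * (fst u)\<^sup>2 + (cmod (\<omega>' s))\<^sup>2 * (snd u)\<^sup>2)"
        using induced_metric_\<Phi>[of t s u u] pU that
        by (simp add: induced_metric_def p(1) power2_eq_square)
      then show ?thesis
        using r_pos[OF p(2), of s] velocity_nz p by (auto simp: add_nonneg_eq_0_iff prod_eq_iff)
    qed
    ultimately show ?thesis using linear_injective_0 by blast
  qed
  moreover have "kaehler_form (differential U \<Phi> p u) (differential U \<Phi> p v) = 0" if "p \<in> U" for p u v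
    unfolding differential_\<Phi>[OF that]
    by (simp add: kaehler_form_def hermitian_def \<Phi>t_def \<Phi>s_def algebra_simps)
  ultimately show ?thesis
    using smooth_\<Phi> by (simp add: lagrangian_immersion_on_def immersion_on_def)
qed

section \<open>Second fundamental form, curvatures and the cubic tensor\<close>

lemma second_fundamental_form_\<Phi>:
  assumes "p \<in> U"
  shows "second_fundamental_form U \<Phi> p u v =
    (let w = (fst u * fst v) *\<^sub>R \<Phi>tt p + (fst u * snd v + snd u * fst v) *\<^sub>R \<Phi>ts p + (snd u * snd v) *\<^sub>R \<Phi>ss p
     in (w \<bullet> J (\<Phi>t p) / (\<Phi>t p \<bullet> \<Phi>t p)) *\<^sub>R J (\<Phi>t p) + (w \<bullet> J (\<Phi>s p) / (\<Phi>s p \<bullet> \<Phi>s p)) *\<^sub>R J (\<Phi>s p))"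
  using assms frame_independent hermitian_\<Phi>t_\<Phi>s
  unfolding second_fundamental_form_def second_derivative_\<Phi>[OF assms] differential_\<Phi>[OF assms] Let_def
  by (cases p) (simp add: normal_component_frame)

lemma curvature_\<alpha>:
  assumes "t \<in> I1"
  shows "Im (\<alpha>'' t * cnj (\<alpha>' t)) = (cmod (\<alpha>' t))\<^sup>2 * (cmod (\<alpha>' t) * signed_curvature I1 \<alpha> t)"
  unfolding signed_curvature_eq[OF I1 assms \<alpha>]
  using velocity_nz(1)[OF assms] by (simp add: complex_div_cnj[of "\<alpha>'' t"] Im_divide_of_real)

lemma curvature_\<omega>:
  assumes "s \<in> I2"
  shows "Im (\<omega>'' s * cnj (\<omega>' s)) = (cmod (\<omega>' s))\<^sup>2 * (cmod (\<omega>' s) * signed_curvature I2 \<omega> s)"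
  unfolding signed_curvature_eq[OF I2 assms \<omega>]
  using velocity_nz(2)[OF assms] by (simp add: complex_div_cnj[of "\<omega>'' s"] Im_divide_of_real)

text \<open>No curvature enters here: the \<open>\<alpha>''\<close> part of \<open>\<Phi>tt\<close>
  is a complex multiple of \<open>\<Phi>t\<close>, hence Hermitian-orthogonal to
  \<open>\<Phi>s\<close>, and likewise for the \<open>\<omega>''\<close> part of
  \<open>\<Phi>ss\<close> against \<open>\<Phi>t\<close>.\<close>

lemma cubic_coefficients:
  "\<Phi>ts (t, s) \<bullet> J (\<Phi>t (t, s)) = (cmod (\<alpha>' t))\<^sup>2 * (\<omega>' s \<bullet> (\<i> * \<omega> s))"
  "\<Phi>tt (t, s) \<bullet> J (\<Phi>s (t, s)) = (cmod (\<alpha>' t))\<^sup>2 * (\<omega>' s \<bullet> (\<i> * \<omega> s))"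
  "\<Phi>ts (t, s) \<bullet> J (\<Phi>s (t, s)) = (cmod (\<omega>' s))\<^sup>2 * (\<alpha>' t \<bullet> (\<i> * \<alpha> t))"
  "\<Phi>ss (t, s) \<bullet> J (\<Phi>t (t, s)) = (cmod (\<omega>' s))\<^sup>2 * (\<alpha>' t \<bullet> (\<i> * \<alpha> t))"
  unfolding cmod_power2
  by (simp_all add: \<Phi>t_def \<Phi>s_def \<Phi>tt_def \<Phi>ts_def \<Phi>ss_def J_def inner_prod_def inner_complex_def
      power2_eq_square algebra_simps)

lemma cubic_ttt:
  assumes "t \<in> I1"
  shows "\<Phi>tt (t, s) \<bullet> J (\<Phi>t (t, s)) =
    (cmod (\<alpha>' t))\<^sup>2 * (r t s * cmod (\<alpha>' t) * signed_curvature I1 \<alpha> t - \<alpha>' t \<bullet> (\<i> * \<alpha> t))"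
proof -
  \<comment> \<open>\<open>\<Phi>tt\<close> is \<open>\<alpha>'' / \<alpha>'\<close> times
    \<open>\<Phi>t\<close> minus a real vector in the first coordinate. The multiple gives the
    curvature term, the real vector the second one.\<close>
  have "\<Phi>tt (t, s) \<bullet> J (\<Phi>t (t, s)) = r t s * Im (\<alpha>'' t * cnj (\<alpha>' t)) - (cmod (\<alpha>' t))\<^sup>2 * (\<alpha>' t \<bullet> (\<i> * \<alpha> t))"
    unfolding r_def cmod_power2
    by (simp add: \<Phi>t_def \<Phi>tt_def J_def inner_prod_def inner_complex_def
  power2_eq_square algebra_simps)
  then show ?thesis unfolding curvature_\<alpha>[OF assms] by (simp add: algebra_simps)
qed

lemma cubic_sss:
  assumes "s \<in> I2"
  shows "\<Phi>ss (t, s) \<bullet> J (\<Phi>s (t, s)) =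
    (cmod (\<omega>' s))\<^sup>2 * (r t s * cmod (\<omega>' s) * signed_curvature I2 \<omega> s - \<omega>' s \<bullet> (\<i> * \<omega> s))"
proof -
  \<comment> \<open>In \<open>\<Phi>ss\<close> the real vector is added instead; the opposite sign
    in the first component of \<open>\<Phi>s\<close> compensates.\<close>
  have "\<Phi>ss (t, s) \<bullet> J (\<Phi>s (t, s)) = r t s * Im (\<omega>'' s * cnj (\<omega>' s)) - (cmod (\<omega>' s))\<^sup>2 * (\<omega>' s \<bullet> (\<i> * \<omega> s))"
    unfolding r_def cmod_power2
    by (simp add: \<Phi>s_def \<Phi>ss_def J_def inner_prod_def inner_complex_def
  power2_eq_square algebra_simps)
  then show ?thesis unfolding curvature_\<omega>[OF assms] by (simp add: algebra_simps)
qed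

text \<open>The normal projection drops out: pairing with the orthogonal frame
  \<open>J \<Phi>t\<close>, \<open>J \<Phi>s\<close> cancels the squared lengths in its
  denominators.\<close>

lemma C_tensor_\<Phi>:
  assumes "p \<in> U"
  shows "C_tensor U \<Phi> p u v w =
    ((fst u * fst v) *\<^sub>R \<Phi>tt p + (fst u * snd v + snd u * fst v) *\<^sub>R \<Phi>ts p + (snd u * snd v) *\<^sub>R \<Phi>ss p)
      \<bullet> (fst w *\<^sub>R J (\<Phi>t p) + snd w *\<^sub>R J (\<Phi>s p))"
proof -
  obtain t s where p: "p = (t, s)" "t \<in> I1" "s \<in> I2" using assms by (auto simp: U_def)
  have "\<Phi>t p \<bullet> \<Phi>t p \<noteq> 0" "\<Phi>s p \<bullet> \<Phi>s p \<noteq> 0"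
    using r_pos[OF p(2), of s] velocity_nz p by (auto simp: metric_coefficients)
  then show ?thesis
    unfolding C_tensor_def differential_\<Phi>[OF assms] second_fundamental_form_\<Phi>[OF assms] Let_def J_add J_scaleR
    by (simp only: inner_add_right inner_scaleR_right) (simp add: inner_add_left J_inner_J metric_coefficients(3,4))
qed

lemma fully_symmetric_C_\<Phi>:
  assumes "p \<in> U"
  shows "fully_symmetric_tensor (C_tensor U \<Phi> p)"
proof -
  obtain t s where p: "p = (t, s)" by fastforce
  \<comment> \<open>Symmetry in the first two slots is visible in the formula; exchanging the last
    two comes down to these coincidences.\<close>
  have s: "\<Phi>ts p \<bullet> J (\<Phi>t p) = \<Phi>tt p \<bullet> J (\<Phi>s p)" "\<Phi>ts p \<bullet> J (\<Phi>s p) = \<Phi>ss p \<bullet> J (\<Phi>t p)"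
    by (simp_all add: p cubic_coefficients)
  show ?thesis
    unfolding fully_symmetric_tensor_def C_tensor_\<Phi>[OF assms]
    by (auto intro!: linearI simp: inner_add_left inner_add_right s algebra_simps)
qed

section \<open>Lagrangian angle and mean curvature\<close>

lemma gram_det_\<Phi>:
  assumes "(t, s) \<in> U"
  shows "gram_det U \<Phi> (t, s) = (r t s * (cmod (\<alpha>' t) * cmod (\<omega>' s)))\<^sup>2"
  by (simp add: gram_det_def induced_metric_\<Phi>[OF assms] power_mult_distrib power2_eq_square)

lemma lagrangian_angle_\<Phi>:
  assumes "(t, s) \<in> U"
  shows "lagrangian_angle U \<Phi> (t, s) = angle_class (Arg (\<alpha>' t) + Arg (\<omega>' s) + pi)"
proof -
  have ts: "t \<in> I1" "s \<in> I2" using assms by (auto simp: U_def)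
  define \<rho> where "\<rho> = r t s * (cmod (\<alpha>' t) * cmod (\<omega>' s))"
  have \<rho>: "0 < \<rho>" using r_pos[OF ts(1)] velocity_nz ts by (simp add: \<rho>_def)
  have "\<alpha>' t * \<omega>' s * r t s = \<rho> * cis (Arg (\<alpha>' t) + Arg (\<omega>' s))"
    using rcis_cmod_Arg[of "\<alpha>' t"] rcis_cmod_Arg[of "\<omega>' s"]
    by (simp add: \<rho>_def rcis_def flip: cis_mult) (metis mult.assoc mult.left_commute mult.commute)
  then have dz: "dz1_wedge_dz2 (\<Phi>t (t, s)) (\<Phi>s (t, s)) = \<rho> * cis (Arg (\<alpha>' t) + Arg (\<omega>' s) + pi)"
    by (simp add: dz1_wedge_dz2_\<Phi>t_\<Phi>s flip: cis_mult[of _ pi])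
  \<comment> \<open>Both 2-forms are multiples of the same determinant in \<open>u\<close> and
    \<open>v\<close>, so the defining condition becomes a single equation for
    \<open>cis \<beta>\<close>.\<close>
  have d: "dz1_wedge_dz2 (differential U \<Phi> (t, s) u) (differential U \<Phi> (t, s) v)
      = dz1_wedge_dz2 (\<Phi>t (t, s)) (\<Phi>s (t, s)) * (fst u * snd v - fst v * snd u)" for u v
    by (simp add: differential_\<Phi>[OF assms] dz1_wedge_dz2_def scaleR_conv_of_real algebra_simps)
  have a: "area_form U \<Phi> (t, s) u v = \<rho> * (fst u * snd v - fst v * snd u)" for u v
    using \<rho> by (simp add: area_form_def gram_det_\<Phi>[OF assms] \<rho>_def)
  have "\<beta> \<in> lagrangian_angle U \<Phi> (t, s) \<longleftrightarrow> cis \<beta> = cis (Arg (\<alpha>' t) + Arg (\<omega>' s) + pi)" for \<beta>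
  proof
    assume "\<beta> \<in> lagrangian_angle U \<Phi> (t, s)"
    then have "dz1_wedge_dz2 (differential U \<Phi> (t, s) (1, 0)) (differential U \<Phi> (t, s) (0, 1))
        = cis \<beta> * complex_of_real (area_form U \<Phi> (t, s) (1, 0) (0, 1))"
      unfolding lagrangian_angle_def by blast
    then show "cis \<beta> = cis (Arg (\<alpha>' t) + Arg (\<omega>' s) + pi)"
      using \<rho> by (simp add: d a dz)
  next
    assume "cis \<beta> = cis (Arg (\<alpha>' t) + Arg (\<omega>' s) + pi)"
    then show "\<beta> \<in> lagrangian_angle U \<Phi> (t, s)"
      by (simp add: lagrangian_angle_def d a dz)
  qed
  then show ?thesis by (auto simp: angle_class_def Real_Mod.cis_eq_iff)
qed

lemma mean_curvature_\<Phi>: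
  assumes "(t, s) \<in> U"
  shows "mean_curvature_vector U \<Phi> (t, s) =
       (1 / r t s) *\<^sub>R
         ((signed_curvature I1 \<alpha> t / cmod (\<alpha>' t)) *\<^sub>R J (\<Phi>t (t, s))
          + (signed_curvature I2 \<omega> s / cmod (\<omega>' s)) *\<^sub>R J (\<Phi>s (t, s)))"
proof -
  have ts: "t \<in> I1" "s \<in> I2" using assms by (auto simp: U_def)
  define a b R k l m n where ab_eqs: "a = cmod (\<alpha>' t)" "b = cmod (\<omega>' s)" "R = r t s"
    "k = signed_curvature I1 \<alpha> t" "l = signed_curvature I2 \<omega> s"
    "m = \<alpha>' t \<bullet> (\<i> * \<alpha> t)" "n = \<omega>' s \<bullet> (\<i> * \<omega> s)"
  have nz: "a \<noteq> 0" "b \<noteq> 0" "R \<noteq> 0"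
    using r_pos[OF ts(1), of s] velocity_nz ts by (auto simp: ab_eqs)
  define X Y where XY: "X = J (\<Phi>t (t, s))" "Y = J (\<Phi>s (t, s))"
  have "mean_curvature_vector U \<Phi> (t, s) = (1 / (R * (a * b))\<^sup>2) *\<^sub>R
      ((R * b\<^sup>2) *\<^sub>R ((a\<^sup>2 * (R * a * k - m) / (R * a\<^sup>2)) *\<^sub>R X + (a\<^sup>2 * n / (R * b\<^sup>2)) *\<^sub>R Y)
       + (R * a\<^sup>2) *\<^sub>R ((b\<^sup>2 * m / (R * a\<^sup>2)) *\<^sub>R X + (b\<^sup>2 * (R * b * l - n) / (R * b\<^sup>2)) *\<^sub>R Y))"
    unfolding mean_curvature_vector_def Let_def gram_det_\<Phi>[OF assms] second_fundamental_form_\<Phi>[OF assms]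
      induced_metric_\<Phi>[OF assms] ab_eqs XY
    by (simp add: metric_coefficients cubic_coefficients cubic_ttt[OF ts(1)] cubic_sss[OF ts(2)])
  also have "\<dots> = ((1 / (R * (a * b))\<^sup>2) * ((R * b\<^sup>2) * (a\<^sup>2 * (R * a * k - m) / (R * a\<^sup>2)) + (R * a\<^sup>2) * (b\<^sup>2 * m / (R * a\<^sup>2)))) *\<^sub>R X
      + ((1 / (R * (a * b))\<^sup>2) * ((R * b\<^sup>2) * (a\<^sup>2 * n / (R * b\<^sup>2)) + (R * a\<^sup>2) * (b\<^sup>2 * (R * b * l - n) / (R * b\<^sup>2)))) *\<^sub>R Y"
    by (simp add: scaleR_add_right scaleR_add_left distrib_left)
  \<comment> \<open>In the trace the \<open>m\<close> from \<open>\<Phi>ss\<close> cancels the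
    \<open>- m\<close> from \<open>\<Phi>tt\<close>, leaving only the curvature; \<open>n\<close>
    cancels in the same way in the \<open>Y\<close> coefficient.\<close>
  also have "(1 / (R * (a * b))\<^sup>2) * ((R * b\<^sup>2) * (a\<^sup>2 * (R * a * k - m) / (R * a\<^sup>2)) + (R * a\<^sup>2) * (b\<^sup>2 * m / (R * a\<^sup>2)))
      = (1 / R) * (k / a)"
    using nz by (simp add: field_simps power2_eq_square)
  also have "(1 / (R * (a * b))\<^sup>2) * ((R * b\<^sup>2) * (a\<^sup>2 * n / (R * b\<^sup>2)) + (R * a\<^sup>2) * (b\<^sup>2 * (R * b * l - n) / (R * b\<^sup>2)))
      = (1 / R) * (l / b)"
    using nz by (simp add: field_simps power2_eq_square)
  finally show ?thesis
    by (simp add: ab_eqs XY scaleR_add_right)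
qed

end

theorem theorem2p1:
  fixes I1 I2 :: "real set" and \<alpha> \<omega> :: "real \<Rightarrow> complex" and t0 s0 :: real
  assumes "is_interval I1" "interior I1 \<noteq> {}"
    and "is_interval I2" "interior I2 \<noteq> {}"
    and "regular_curve_on I1 \<alpha>" "\<forall>t\<in>I1. \<alpha> t \<noteq> 0"
    and "regular_curve_on I2 \<omega>" "\<forall>s\<in>I2. \<omega> s \<noteq> 0"
    and "t0 \<in> I1" "s0 \<in> I2"
  defines "U \<equiv> I1 \<times> I2"
    and "\<Phi> \<equiv> curve_product I1 I2 t0 s0 \<alpha> \<omega>"
    and "\<alpha>' \<equiv> velocity I1 \<alpha>"
    and "\<omega>' \<equiv> velocity I2 \<omega>"
    and "\<kappa>\<alpha> \<equiv> signed_curvature I1 \<alpha>"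
    and "\<kappa>\<omega> \<equiv> signed_curvature I2 \<omega>"
    and "r \<equiv> (\<lambda>t s. (cmod (\<alpha> t))\<^sup>2 + (cmod (\<omega> s))\<^sup>2)"
  shows "lagrangian_immersion_on U \<Phi> \<and>
    (\<forall>t\<in>I1. \<forall>s\<in>I2. \<forall>u v. induced_metric U \<Phi> (t, s) u v =
       r t s * ((cmod (\<alpha>' t))\<^sup>2 * (fst u * fst v) + (cmod (\<omega>' s))\<^sup>2 * (snd u * snd v))) \<and>
    (\<forall>t\<in>I1. \<forall>s\<in>I2. let C = C_tensor U \<Phi> (t, s) in
       fully_symmetric_tensor C \<and>
       C \<partial>\<^sub>t \<partial>\<^sub>t \<partial>\<^sub>t = (cmod (\<alpha>' t))\<^sup>2 * (r t s * cmod (\<alpha>' t) * \<kappa>\<alpha> t - \<alpha>' t \<bullet> (\<i> * \<alpha> t)) \<and>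
       C \<partial>\<^sub>t \<partial>\<^sub>t \<partial>\<^sub>s = (cmod (\<alpha>' t))\<^sup>2 * (\<omega>' s \<bullet> (\<i> * \<omega> s)) \<and>
       C \<partial>\<^sub>t \<partial>\<^sub>s \<partial>\<^sub>s = (cmod (\<omega>' s))\<^sup>2 * (\<alpha>' t \<bullet> (\<i> * \<alpha> t)) \<and>
       C \<partial>\<^sub>s \<partial>\<^sub>s \<partial>\<^sub>s = (cmod (\<omega>' s))\<^sup>2 * (r t s * cmod (\<omega>' s) * \<kappa>\<omega> s - \<omega>' s \<bullet> (\<i> * \<omega> s))) \<and>
    (\<forall>t\<in>I1. \<forall>s\<in>I2. lagrangian_angle U \<Phi> (t, s) =
       angle_class (Arg (\<alpha>' t) + Arg (\<omega>' s) + pi)) \<and>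
    (\<forall>t\<in>I1. \<forall>s\<in>I2. mean_curvature_vector U \<Phi> (t, s) =
       (1 / r t s) *\<^sub>R
         ((\<kappa>\<alpha> t / cmod (\<alpha>' t)) *\<^sub>R J (differential U \<Phi> (t, s) \<partial>\<^sub>t)
          + (\<kappa>\<omega> s / cmod (\<omega>' s)) *\<^sub>R J (differential U \<Phi> (t, s) \<partial>\<^sub>s)))"
proof -
  interpret P: curve_pair I1 I2 \<alpha> \<omega> t0 s0
    using assms(1-10) by unfold_locales
  have defs: "U = P.U" "\<Phi> = P.\<Phi>" "r = P.r"
    by (simp_all add: U_def P.U_def \<Phi>_def P.\<Phi>_def r_def P.r_def fun_eq_iff)
  have U: "(t, s) \<in> P.U" if "t \<in> I1" "s \<in> I2" for t s
    using that by (simp add: P.U_def)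
  show ?thesis
    unfolding defs \<alpha>'_def \<omega>'_def \<kappa>\<alpha>_def \<kappa>\<omega>_def Let_def
    by (intro conjI ballI allI)
      (simp_all add: U P.lagrangian_\<Phi> P.induced_metric_\<Phi> P.fully_symmetric_C_\<Phi> P.C_tensor_\<Phi>
        P.cubic_ttt P.cubic_sss P.cubic_coefficients P.lagrangian_angle_\<Phi> P.mean_curvature_\<Phi> P.differential_\<Phi>)
qed

end
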